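(* Let $\rho=\begin{bmatrix}-I_{d/2}&0\\0&I_{d/2}\end{bmatrix}$ act on $\mathbf y=(\mathbf p,\mathbf q)\in\mathbb R^{d/2}\times\mathbb R^{d/2}$. A symmetric GARK scheme applied to $\mathbf y'=\sum_{m=1}^N\mathbf f^{\{m\}}(\mathbf y)$ is $\rho$-reversible (time-reversible), i.e. its one-step map $\Phi_h$ satisfies $\rho\circ\Phi_h\circ\rho\circ\Phi_h(\mathbf y_0)=\mathbf y_0$, provided that all individual components are $\rho$-reversible: $$\rho\,\mathbf f^{\{m\}}(\mathbf y)=-\mathbf f^{\{m\}}(\rho\,\mathbf y),\qquad m=1,\dots,N.$$
   Context: GARK scheme. Real coefficients $\mathbf A^{\{q,m\}}=(a_{i,j}^{\{q,m\}})\in\mathbb R^{s^{\{q\}}\times s^{\{m\}}}$, $\mathbf b^{\{m\}}\in\mathbb R^{s^{\{m\}}}$, $q,m=1,\dots,N$. Applied to $\mathbf y'=\sum_m\mathbf f^{\{m\}}(\mathbf y)$, $\mathbf f^{\{m\}}:\mathbb R^d\to\mathbb R^d$ smooth, with step size $h$ it defines $\Phi_h:\mathbf y_0\mapsto\mathbf y_1$ by $$Y_i^{\{q\}}=\mathbf y_0+h\sum_{m=1}^{N}\sum_{j=1}^{s^{\{m\}}}a_{i,j}^{\{q,m\}}\mathbf f^{\{m\}}(Y_j^{\{m\}}),\qquad \mathbf y_1=\mathbf y_0+h\sum_{q=1}^{N}\sum_{i=1}^{s^{\{q\}}}b_i^{\{q\}}\mathbf f^{\{q\}}(Y_i^{\{q\}}).$$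 As usual for implicit schemes, $|h|$ is understood to be small enough that the stage equations involved are uniquely solvable, so that $\Phi_h$ and $\Phi_{-h}$ are well-defined maps. Symmetric. The GARK scheme is symmetric if its coefficients are invariant under time reversal: for all $\ell,m$ and all $i,j$, $$b_j^{\{m\}}=b^{\{m\}}_{s^{\{m\}}+1-j},\qquad a_{i,j}^{\{\ell,m\}}=b_j^{\{m\}}-a^{\{\ell,m\}}_{s^{\{\ell\}}+1-i,\,s^{\{m\}}+1-j}.$$ *)

theory Defs
  imports "HOL-Analysis.Analysis"
begin

text \<open>Parts are indexed by \<open>{1..parts}\<close> and the stages of part \<open>m\<close> by \<open>{1..stages m}\<close>;
  \<open>coeff_a q m i j\<close> is $a_{i,j}^{\{q,m\}}$ and \<open>coeff_b m j\<close> is $b_j^{\{m\}}$.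
  Values outside these index ranges are never used.\<close>

record gark =
  parts :: nat
  stages :: "nat \<Rightarrow> nat"
  coeff_a :: "nat \<Rightarrow> nat \<Rightarrow> nat \<Rightarrow> nat \<Rightarrow> real"
  coeff_b :: "nat \<Rightarrow> nat \<Rightarrow> real"

definition stage_index :: "gark \<Rightarrow> (nat \<times> nat) set" where
  "stage_index G = (SIGMA q:{1..parts G}. {1..stages G q})"

text \<open>Stage vectors are taken extensional, so that uniqueness of \<open>Y\<close> means uniqueness of the
  actual stage values \<open>Y (q, i)\<close>.\<close>

definition stage_solution ::
  "gark \<Rightarrow> (nat \<Rightarrow> 'a::real_vector \<Rightarrow> 'a) \<Rightarrow> real \<Rightarrow> 'a \<Rightarrow> (nat \<times> nat \<Rightarrow> 'a) \<Rightarrow> bool" where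
  "stage_solution G f h y0 Y \<longleftrightarrow>
     Y \<in> extensional (stage_index G) \<and>
     (\<forall>q\<in>{1..parts G}. \<forall>i\<in>{1..stages G q}.
        Y (q, i) = y0 + h *\<^sub>R (\<Sum>m=1..parts G. \<Sum>j=1..stages G m.
                                coeff_a G q m i j *\<^sub>R f m (Y (m, j))))"

definition uniquely_solvable ::
  "gark \<Rightarrow> (nat \<Rightarrow> 'a::real_vector \<Rightarrow> 'a) \<Rightarrow> real \<Rightarrow> 'a \<Rightarrow> bool" where
  "uniquely_solvable G f h y0 \<longleftrightarrow> (\<exists>!Y. stage_solution G f h y0 Y)"

text \<open>The one-step map $\Phi_h$; meaningful at \<open>y0\<close> only if \<open>uniquely_solvable G f h y0\<close>.\<close>

definition gark_step ::
  "gark \<Rightarrow> (nat \<Rightarrow> 'a::real_vector \<Rightarrow> 'a) \<Rightarrow> real \<Rightarrow> 'a \<Rightarrow> 'a" where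
  "gark_step G f h y0 =
     (let Y = (THE Y. stage_solution G f h y0 Y)
      in y0 + h *\<^sub>R (\<Sum>q=1..parts G. \<Sum>i=1..stages G q. coeff_b G q i *\<^sub>R f q (Y (q, i))))"

definition symmetric_gark :: "gark \<Rightarrow> bool" where
  "symmetric_gark G \<longleftrightarrow>
     (\<forall>m\<in>{1..parts G}. \<forall>j\<in>{1..stages G m}.
        coeff_b G m j = coeff_b G m (stages G m + 1 - j)) \<and>
     (\<forall>l\<in>{1..parts G}. \<forall>m\<in>{1..parts G}. \<forall>i\<in>{1..stages G l}. \<forall>j\<in>{1..stages G m}.
        coeff_a G l m i j =
          coeff_b G m j - coeff_a G l m (stages G l + 1 - i) (stages G m + 1 - j))"

text \<open>$C^k$ on the whole space: in finite dimension, $Df$ is $C^k$ iff all directional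
  derivatives \<open>\<lambda>x. Df(x) v\<close> are.\<close>

primrec C_k :: "nat \<Rightarrow> ('a::euclidean_space \<Rightarrow> 'b::euclidean_space) \<Rightarrow> bool" where
  "C_k 0 f \<longleftrightarrow> continuous_on UNIV f"
| "C_k (Suc k) f \<longleftrightarrow>
     (\<forall>x. f differentiable (at x)) \<and> (\<forall>v. C_k k (\<lambda>x. frechet_derivative f (at x) v))"

definition smooth :: "('a::euclidean_space \<Rightarrow> 'b::euclidean_space) \<Rightarrow> bool" where
  "smooth f \<longleftrightarrow> (\<forall>k. C_k k f)"

text \<open>The state space $\mathbb R^d = \mathbb R^{d/2} \times \mathbb R^{d/2}$, with
  $d/2$ = \<open>CARD('n)\<close>, is the product type, with elements \<open>(p, q)\<close>.\<close>

definition rho :: "(real^'n) \<times> (real^'n) \<Rightarrow> (real^'n) \<times> (real^'n)" where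
  "rho y = (- fst y, snd y)"

definition rho_reversible_field ::
  "((real^'n) \<times> (real^'n) \<Rightarrow> (real^'n) \<times> (real^'n)) \<Rightarrow> bool" where
  "rho_reversible_field g \<longleftrightarrow> (\<forall>y. rho (g y) = - g (rho y))"

end

theory Submission
  imports Defs
begin

text \<open>Listing the stages of each part in reverse order turns the stage equations of a symmetric
  scheme for step \<open>h\<close> at \<open>y0\<close> into those for step \<open>-h\<close> at \<open>y1\<close>; hence \<open>\<Phi>\<^bsub>-h\<^esub>\<close> inverts \<open>\<Phi>\<^bsub>h\<^esub>\<close>.
  Applying \<open>\<rho>\<close> to all stages of a solution for step \<open>h\<close> at \<open>y\<close> gives a solution for step \<open>-h\<close> at
  \<open>\<rho> y\<close>. The two reflections together produce the unique stage vector of the step that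
  starts at \<open>\<rho> y1\<close>, and its output is \<open>\<rho> y0\<close>.\<close>

text \<open>The stage vector is an explicit argument because for step \<open>- h\<close> only the
  existence of a solution is established, not its uniqueness.\<close>

definition gark_output ::
  "gark \<Rightarrow> (nat \<Rightarrow> 'a::real_vector \<Rightarrow> 'a) \<Rightarrow> real \<Rightarrow> 'a \<Rightarrow> (nat \<times> nat \<Rightarrow> 'a) \<Rightarrow> 'a" where
  "gark_output G f h y0 Y =
     y0 + h *\<^sub>R (\<Sum>q=1..parts G. \<Sum>i=1..stages G q. coeff_b G q i *\<^sub>R f q (Y (q, i)))"

text \<open>Restricting to \<open>stage_index G\<close> keeps the result extensional, as
  \<open>stage_solution\<close> demands.\<close>

definition reverse_stages :: "gark \<Rightarrow> (nat \<times> nat \<Rightarrow> 'a) \<Rightarrow> nat \<times> nat \<Rightarrow> 'a" where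
  "reverse_stages G Y = (\<lambda>(q, i)\<in>stage_index G. Y (q, stages G q + 1 - i))"

definition map_stages :: "gark \<Rightarrow> ('a \<Rightarrow> 'a) \<Rightarrow> (nat \<times> nat \<Rightarrow> 'a) \<Rightarrow> nat \<times> nat \<Rightarrow> 'a" where
  "map_stages G R Y = (\<lambda>qi\<in>stage_index G. R (Y qi))"

lemma reverse_stages_apply:
  "q \<in> {1..parts G} \<Longrightarrow> i \<in> {1..stages G q} \<Longrightarrow>
    reverse_stages G Y (q, i) = Y (q, stages G q + 1 - i)"
  by (simp add: reverse_stages_def stage_index_def)

lemma map_stages_apply:
  "q \<in> {1..parts G} \<Longrightarrow> i \<in> {1..stages G q} \<Longrightarrow> map_stages G R Y (q, i) = R (Y (q, i))"
  by (simp add: map_stages_def stage_index_def)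

lemma gark_step_eq_output:
  assumes "uniquely_solvable G f h y0" "stage_solution G f h y0 Y"
  shows "gark_step G f h y0 = gark_output G f h y0 Y"
proof -
  have "(THE Y. stage_solution G f h y0 Y) = Y"
    using assms unfolding uniquely_solvable_def by (blast intro: the1_equality)
  then show ?thesis
    by (simp add: gark_step_def gark_output_def Let_def)
qed

text \<open>Reindexing each inner sum moves the reversal from the stage values to the coefficients.
  As \<open>c\<close> is arbitrary, this serves both the weights and every row of
  \<open>coeff_a\<close>.\<close>

lemma sum_reverse_stages:
  fixes F :: "nat \<Rightarrow> 'a \<Rightarrow> 'b::real_vector"
  shows "(\<Sum>m=1..parts G. \<Sum>j=1..stages G m. c m j *\<^sub>R F m (reverse_stages G Y (m, j))) =
    (\<Sum>m=1..parts G. \<Sum>j=1..stages G m. c m (stages G m + 1 - j) *\<^sub>R F m (Y (m, j)))"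
proof (rule sum.cong[OF refl])
  fix m assume m: "m \<in> {1..parts G}"
  have "(\<Sum>j=1..stages G m. c m j *\<^sub>R F m (reverse_stages G Y (m, j))) =
      (\<Sum>j=1..stages G m. c m j *\<^sub>R F m (Y (m, stages G m + 1 - j)))"
    using m by (intro sum.cong refl) (simp add: reverse_stages_apply)
  also have "\<dots> = (\<Sum>j=1..stages G m. c m (stages G m + 1 - j) *\<^sub>R F m (Y (m, j)))"
    by (subst sum.atLeastAtMost_rev) (auto intro!: sum.cong)
  finally show "(\<Sum>j=1..stages G m. c m j *\<^sub>R F m (reverse_stages G Y (m, j))) =
      (\<Sum>j=1..stages G m. c m (stages G m + 1 - j) *\<^sub>R F m (Y (m, j)))" .
qed

lemma symmetric_gark_b:
  assumes "symmetric_gark G" "m \<in> {1..parts G}" "j \<in> {1..stages G m}"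
  shows "coeff_b G m (stages G m + 1 - j) = coeff_b G m j"
  using assms unfolding symmetric_gark_def by metis

lemma symmetric_gark_a:
  assumes "symmetric_gark G" "l \<in> {1..parts G}" "m \<in> {1..parts G}"
    "i \<in> {1..stages G l}" "j \<in> {1..stages G m}"
  shows "coeff_a G l m (stages G l + 1 - i) j =
    coeff_b G m j - coeff_a G l m i (stages G m + 1 - j)"
proof -
  have "stages G l + 1 - i \<in> {1..stages G l}" "stages G l + 1 - (stages G l + 1 - i) = i"
    using assms(4) by auto
  then show ?thesis
    using assms unfolding symmetric_gark_def by metis
qed

text \<open>The weights are palindromic, so the reversed stages give the same increment, and the
  steps \<open>h\<close> and \<open>- h\<close> cancel.\<close>

lemma gark_output_reverse_stages:
  assumes "symmetric_gark G"
  shows "gark_output G f (- h) (gark_output G f h y0 Y) (reverse_stages G Y) = y0"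
  unfolding gark_output_def sum_reverse_stages
  by (simp add: symmetric_gark_b[OF assms, simplified])

text \<open>By symmetry a reflected row of \<open>coeff_a\<close> is the weights minus the original
  row reversed. The weights carry \<open>y0\<close> to the output, and the rest is the stage sum for
  step \<open>- h\<close>.\<close>

lemma stage_solution_reverse_stages:
  assumes sym: "symmetric_gark G" and sol: "stage_solution G f h y0 Y"
  shows "stage_solution G f (- h) (gark_output G f h y0 Y) (reverse_stages G Y)"
  unfolding stage_solution_def
proof (intro conjI ballI)
  show "reverse_stages G Y \<in> extensional (stage_index G)"
    by (simp add: reverse_stages_def)
next
  fix q i assume q: "q \<in> {1..parts G}" and i: "i \<in> {1..stages G q}"
  let ?i = "stages G q + 1 - i"
  let ?A = "\<Sum>m=1..parts G. \<Sum>j=1..stages G m.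
    coeff_a G q m i (stages G m + 1 - j) *\<^sub>R f m (Y (m, j))"
  let ?B = "\<Sum>m=1..parts G. \<Sum>j=1..stages G m. coeff_b G m j *\<^sub>R f m (Y (m, j))"
  have "?i \<in> {1..stages G q}"
    using i by auto
  then have "reverse_stages G Y (q, i) =
      y0 + h *\<^sub>R (\<Sum>m=1..parts G. \<Sum>j=1..stages G m. coeff_a G q m ?i j *\<^sub>R f m (Y (m, j)))"
    using sol q i unfolding stage_solution_def by (simp only: reverse_stages_apply)
  also have "(\<Sum>m=1..parts G. \<Sum>j=1..stages G m. coeff_a G q m ?i j *\<^sub>R f m (Y (m, j))) =
      (\<Sum>m=1..parts G. \<Sum>j=1..stages G m.
        (coeff_b G m j - coeff_a G q m i (stages G m + 1 - j)) *\<^sub>R f m (Y (m, j)))"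
    using q i by (intro sum.cong refl) (simp only: symmetric_gark_a[OF sym])
  also have "\<dots> = ?B - ?A"
    by (simp only: scaleR_diff_left sum_subtractf)
  \<comment> \<open>\<open>h *\<^sub>R ?B\<close> is exactly the increment of the step, so it is
    absorbed into the new initial value.\<close>
  also have "y0 + h *\<^sub>R (?B - ?A) = gark_output G f h y0 Y + (- h) *\<^sub>R ?A"
    by (simp add: gark_output_def scaleR_diff_right)
  also have "?A = (\<Sum>m=1..parts G. \<Sum>j=1..stages G m.
      coeff_a G q m i j *\<^sub>R f m (reverse_stages G Y (m, j)))"
    by (rule sum_reverse_stages[symmetric])
  finally show "reverse_stages G Y (q, i) = gark_output G f h y0 Y +
      (- h) *\<^sub>R (\<Sum>m=1..parts G. \<Sum>j=1..stages G m.
        coeff_a G q m i j *\<^sub>R f m (reverse_stages G Y (m, j)))" .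
qed

context
  fixes G :: gark and f :: "nat \<Rightarrow> 'a::real_vector \<Rightarrow> 'a" and R :: "'a \<Rightarrow> 'a"
  assumes lin: "linear R"
    and anti: "\<And>m y. m \<in> {1..parts G} \<Longrightarrow> f m (R y) = - R (f m y)"
begin

text \<open>Linearity pulls \<open>R\<close> out of the sums; the sign from \<open>anti\<close> is
  what turns step \<open>h\<close> into \<open>- h\<close> below.\<close>

lemma sum_map_stages:
  "(\<Sum>m=1..parts G. \<Sum>j=1..stages G m. c m j *\<^sub>R f m (map_stages G R Y (m, j))) =
    - R (\<Sum>m=1..parts G. \<Sum>j=1..stages G m. c m j *\<^sub>R f m (Y (m, j)))"
  unfolding linear_sum[OF lin] linear_scale[OF lin] sum_negf[symmetric]
  by (intro sum.cong refl) (simp add: map_stages_apply anti)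

lemma gark_output_map_stages:
  "gark_output G f (- h) (R y0) (map_stages G R Y) = R (gark_output G f h y0 Y)"
  unfolding gark_output_def sum_map_stages by (simp add: linear_add[OF lin] linear_scale[OF lin])

lemma stage_solution_map_stages:
  assumes "stage_solution G f h y0 Y"
  shows "stage_solution G f (- h) (R y0) (map_stages G R Y)"
  unfolding stage_solution_def sum_map_stages
proof (intro conjI ballI)
  show "map_stages G R Y \<in> extensional (stage_index G)"
    by (simp add: map_stages_def)
next
  fix q i assume q: "q \<in> {1..parts G}" and i: "i \<in> {1..stages G q}"
  let ?S = "\<Sum>m=1..parts G. \<Sum>j=1..stages G m. coeff_a G q m i j *\<^sub>R f m (Y (m, j))"
  have "map_stages G R Y (q, i) = R (y0 + h *\<^sub>R ?S)"
    using assms q i unfolding stage_solution_def by (simp only: map_stages_apply)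
  then show "map_stages G R Y (q, i) = R y0 + (- h) *\<^sub>R - R ?S"
    by (simp add: linear_add[OF lin] linear_scale[OF lin])
qed

text \<open>Reversibility for a general linear \<open>R\<close>; when \<open>R\<close> is an
  involution, applying it to both sides gives the usual form.\<close>

theorem symmetric_gark_step_reversible:
  assumes sym: "symmetric_gark G"
    and solv0: "uniquely_solvable G f h y0"
    and solv1: "uniquely_solvable G f h (R (gark_step G f h y0))"
  shows "gark_step G f h (R (gark_step G f h y0)) = R y0"
proof -
  obtain Y where Y: "stage_solution G f h y0 Y"
    using solv0 unfolding uniquely_solvable_def by blast
  define y1 where "y1 = gark_output G f h y0 Y"
  define Z where "Z = map_stages G R (reverse_stages G Y)"
  have step: "gark_step G f h y0 = y1"
    unfolding y1_def by (rule gark_step_eq_output[OF solv0 Y])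
  \<comment> \<open>Each of the two reflections negates the step size, so \<open>Z\<close> belongs
    to step \<open>h\<close> again.\<close>
  have "stage_solution G f h (R y1) Z"
    using stage_solution_map_stages[OF stage_solution_reverse_stages[OF sym Y]]
    by (simp add: y1_def Z_def)
  then have "gark_step G f h (R y1) = gark_output G f h (R y1) Z"
    using solv1 by (simp add: step gark_step_eq_output)
  also have "\<dots> = R (gark_output G f (- h) y1 (reverse_stages G Y))"
    using gark_output_map_stages[of "- h"] by (simp add: Z_def)
  also have "\<dots> = R y0"
    by (simp add: y1_def gark_output_reverse_stages[OF sym])
  finally show ?thesis
    by (simp add: step)
qed

end

lemma linear_rho: "linear rho"
  by (rule linearI) (simp_all add: rho_def)

lemma rho_rho: "rho (rho y) = y"
  by (simp add: rho_def)

theorem theorem3p7: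
  fixes G :: gark
    and f :: "nat \<Rightarrow> (real^'n) \<times> (real^'n) \<Rightarrow> (real^'n) \<times> (real^'n)"
    and h :: real
    and y0 :: "(real^'n) \<times> (real^'n)"
  assumes "symmetric_gark G"
    and "\<And>m. m \<in> {1..parts G} \<Longrightarrow> smooth (f m)"
    and "\<And>m. m \<in> {1..parts G} \<Longrightarrow> rho_reversible_field (f m)"
    and "uniquely_solvable G f h y0"
    and "uniquely_solvable G f h (rho (gark_step G f h y0))"
  shows "(rho \<circ> gark_step G f h \<circ> rho \<circ> gark_step G f h) y0 = y0"
proof -
  have "f m (rho y) = - rho (f m y)" if "m \<in> {1..parts G}" for m y
    using assms(3)[OF that] unfolding rho_reversible_field_def by (metis minus_minus)
  then have "gark_step G f h (rho (gark_step G f h y0)) = rho y0"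
    by (intro symmetric_gark_step_reversible linear_rho assms(1,4,5))
  then show ?thesis
    by (simp add: rho_rho)
qed

end
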